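(* For $k \in \{2,3\}$, $\mathrm{cov}(2,k) = k$. That is, for $k\in\{2,3\}$: (i) in every spanning $k$-coloring of the edges of a complete bipartite graph $G$, the vertex set $V(G)$ can be covered by the vertex sets of at most $k$ monochromatic components; and (ii) there exist a complete bipartite graph and a spanning $k$-coloring of its edges for which fewer than $k$ monochromatic components do not suffice to cover its vertex set.
   Context: A complete bipartite graph (biclique) has vertex set partitioned into nonempty parts $X$ and $Y$ with every pair $xy$, $x\in X$, $y\in Y$, an edge. A $k$-coloring of the edges assigns one of $k$ colors to each edge; it is spanning if every vertex is incident to edges of every one of the $k$ colors. A monochromatic component of color $c$ is a connected component (possibly a single vertex) of the spanning subgraph consisting of all edges of color $c$. A set of monochromatic components covers $V(G)$ if every vertex lies in one of them. The covering number $\mathrm{cov}(2,k)$ is the minimum integer $\ell$ such that for every spanning $k$-coloring of the edges of every complete bipartite graph $G$, $V(G)$ can be covered by at most $\ell$ monochromatic components. *)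

theory Defs
  imports "Graph_Theory.Graph_Theory"
begin

text \<open>
  As in the Graph-Theory library, a finite simple graph is a symmetric digraph: the edge $uv$
  is the pair of arcs $(u,v)$, $(v,u)$.
\<close>

definition biclique :: "'a pair_pre_digraph \<Rightarrow> bool" where
  "biclique G \<longleftrightarrow> (\<exists>m > 0. \<exists>n > 0. K\<^bsub>m,n\<^esub> (with_proj G))"

text \<open>
  The colors are $0, \dots, k-1$. A coloring is a function on unordered pairs, so both
  arcs of an edge have the same color; its values outside the edge set are irrelevant.
\<close>

definition edge_coloring :: "nat \<Rightarrow> 'a pair_pre_digraph \<Rightarrow> ('a set \<Rightarrow> nat) \<Rightarrow> bool" where
  "edge_coloring k G f \<longleftrightarrow> (\<forall>(u, v) \<in> parcs G. f {u, v} < k)"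

definition spanning_coloring :: "nat \<Rightarrow> 'a pair_pre_digraph \<Rightarrow> ('a set \<Rightarrow> nat) \<Rightarrow> bool" where
  "spanning_coloring k G f \<longleftrightarrow> edge_coloring k G f \<and>
     (\<forall>v \<in> pverts G. \<forall>c < k. \<exists>u. (v, u) \<in> parcs G \<and> f {v, u} = c)"

definition color_subgraph ::
    "'a pair_pre_digraph \<Rightarrow> ('a set \<Rightarrow> nat) \<Rightarrow> nat \<Rightarrow> 'a pair_pre_digraph" where
  "color_subgraph G f c =
     \<lparr> pverts = pverts G, parcs = {(u, v) \<in> parcs G. f {u, v} = c} \<rparr>"

text \<open>
  The color subgraphs are symmetric digraphs, so their strongly connected components are
  the connected components of the corresponding undirected graphs, isolated vertices included.
\<close>

definition mono_components ::
    "nat \<Rightarrow> 'a pair_pre_digraph \<Rightarrow> ('a set \<Rightarrow> nat) \<Rightarrow> ('a, 'a \<times> 'a) pre_digraph set" where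
  "mono_components k G f =
     (\<Union>c \<in> {..<k}. pre_digraph.sccs (with_proj (color_subgraph G f c)))"

definition coverable :: "nat \<Rightarrow> 'a pair_pre_digraph \<Rightarrow> ('a set \<Rightarrow> nat) \<Rightarrow> nat \<Rightarrow> bool" where
  "coverable k G f l \<longleftrightarrow>
     (\<exists>\<C> \<subseteq> mono_components k G f. finite \<C> \<and> card \<C> \<le> l \<and> pverts G \<subseteq> (\<Union>C \<in> \<C>. verts C))"

text \<open>
  The covering number $\mathrm{cov}(2,k)$. Every finite graph is isomorphic to one whose vertices are
  natural numbers, so it suffices to let the graphs range over this type.
\<close>

definition cov2 :: "nat \<Rightarrow> nat" where
  "cov2 k = (LEAST l. \<forall>(G :: nat pair_pre_digraph) f.
     biclique G \<longrightarrow> spanning_coloring k G f \<longrightarrow> coverable k G f l)"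

end

theory Submission
  imports Defs
begin

text \<open>
  Record each vertex by the tuple of its monochromatic components. Every point of \<open>X\<close> agrees with
  every point of \<open>Y\<close> in some coordinate, and spanning means that \<open>X\<close> and \<open>Y\<close> have the same
  projections. For three colors, if all points of \<open>X\<close> pairwise agree somewhere, the components of
  any single point of \<open>X\<close> cover. Otherwise let \<open>p = (0,0,0)\<close> and \<open>p' = (1,1,1)\<close> be in \<open>X\<close>. A point of
  \<open>Y\<close> whose first coordinate is not in \<open>{0,1}\<close> then has the form \<open>(n,0,1)\<close> or \<open>(n,1,0)\<close>; if there is
  no cover, both types occur in each coordinate, with distinct values \<open>n\<close>. A point of \<open>X\<close> with
  first coordinate outside \<open>{0,1}\<close> cannot agree with all of these. The lower bound comes from the
  proper \<open>k\<close>-edge-coloring of \<open>K\<^bsub>k,k\<^esub>\<close>, whose components are single edges.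
\<close>

section \<open>Labelings that agree across two sets\<close>

text \<open>Two shapes of cover are ruled out: three classes of one labeling, and one class of each
  labeling. The condition survives every permutation of the labelings, so whatever is proved about
  \<open>a\<close> transfers to \<open>b\<close> and \<open>c\<close>.\<close>

definition uncovered3 :: "'v set \<Rightarrow> 'v set \<Rightarrow> ('v \<Rightarrow> 'l) \<Rightarrow> ('v \<Rightarrow> 'l) \<Rightarrow> ('v \<Rightarrow> 'l) \<Rightarrow> bool" where
  "uncovered3 X Y a b c \<longleftrightarrow>
     (\<forall>x\<in>X. \<forall>y\<in>Y. a x = a y \<or> b x = b y \<or> c x = c y) \<and>
     (\<forall>h\<in>{a, b, c}. h ` X = h ` Y \<and>
        (\<forall>u\<in>X \<union> Y. \<forall>v\<in>X \<union> Y. \<forall>w\<in>X \<union> Y. \<exists>z\<in>X \<union> Y. h z \<noteq> h u \<and> h z \<noteq> h v \<and> h z \<noteq> h w)) \<and>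
     (\<forall>u\<in>X \<union> Y. \<forall>v\<in>X \<union> Y. \<forall>w\<in>X \<union> Y. \<exists>z\<in>X \<union> Y. a z \<noteq> a u \<and> b z \<noteq> b v \<and> c z \<noteq> c w)"

lemma uncovered3_agree:
  assumes "uncovered3 X Y a b c" "x \<in> X" "y \<in> Y"
  shows "a x = a y \<or> b x = b y \<or> c x = c y"
  using assms(1)[unfolded uncovered3_def, THEN conjunct1, THEN bspec, OF assms(2), THEN bspec, OF assms(3)] .

lemma uncovered3_escape:
  assumes "uncovered3 X Y a b c" "u \<in> X \<union> Y" "v \<in> X \<union> Y" "w \<in> X \<union> Y"
  shows "\<exists>z\<in>X \<union> Y. a z \<noteq> a u \<and> b z \<noteq> b v \<and> c z \<noteq> c w"
  using assms(1)[unfolded uncovered3_def, THEN conjunct2, THEN conjunct2, THEN bspec, OF assms(2),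
      THEN bspec, OF assms(3), THEN bspec, OF assms(4)] .

lemma uncovered3_rotate:
  assumes unc: "uncovered3 X Y a b c"
  shows "uncovered3 X Y b c a"
  unfolding uncovered3_def
proof (intro conjI ballI)
  show "b x = b y \<or> c x = c y \<or> a x = a y" if "x \<in> X" "y \<in> Y" for x y
    using uncovered3_agree[OF unc that] by argo
  show "\<exists>z\<in>X \<union> Y. b z \<noteq> b u \<and> c z \<noteq> c v \<and> a z \<noteq> a w"
    if "u \<in> X \<union> Y" "v \<in> X \<union> Y" "w \<in> X \<union> Y" for u v w
    using uncovered3_escape[OF unc that(3,1,2)] by (elim bexE) (rule bexI, simp_all)
next
  note H = unc[unfolded uncovered3_def, THEN conjunct2, THEN conjunct1]
  fix h assume "h \<in> {b, c, a}"
  then have h: "h \<in> {a, b, c}" by auto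
  show "h ` X = h ` Y" using H[rule_format, OF h] by (rule conjunct1)
  show "\<exists>z\<in>X \<union> Y. h z \<noteq> h u \<and> h z \<noteq> h v \<and> h z \<noteq> h w"
    if "u \<in> X \<union> Y" "v \<in> X \<union> Y" "w \<in> X \<union> Y" for u v w
    using H[THEN bspec, OF h, THEN conjunct2, THEN bspec, OF that(1), THEN bspec, OF that(2),
        THEN bspec, OF that(3)] .
qed

text \<open>An escaping point may lie on either side, but the equal projections of \<open>X\<close>
  and \<open>Y\<close> realize its label on both.\<close>

lemma uncovered3_fresh:
  assumes unc: "uncovered3 X Y a b c" and uvw: "u \<in> X \<union> Y" "v \<in> X \<union> Y" "w \<in> X \<union> Y"
  shows "\<exists>x\<in>X. a x \<noteq> a u \<and> a x \<noteq> a v \<and> a x \<noteq> a w"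
    and "\<exists>y\<in>Y. a y \<noteq> a u \<and> a y \<noteq> a v \<and> a y \<noteq> a w"
proof -
  note H = unc[unfolded uncovered3_def, THEN conjunct2, THEN conjunct1, THEN bspec, OF insertI1]
  obtain z where z: "z \<in> X \<union> Y" "a z \<noteq> a u" "a z \<noteq> a v" "a z \<noteq> a w"
    using H[THEN conjunct2, THEN bspec, OF uvw(1), THEN bspec, OF uvw(2), THEN bspec, OF uvw(3)]
    by blast
  have "a z \<in> a ` X" "a z \<in> a ` Y"
    using z(1) H[THEN conjunct1] by blast+
  then obtain x y where xy: "x \<in> X" "y \<in> Y" "a z = a x" "a z = a y"
    by (elim imageE)
  show "\<exists>x\<in>X. a x \<noteq> a u \<and> a x \<noteq> a v \<and> a x \<noteq> a w"
    using xy(1) z(2-4) unfolding xy(3) by blast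
  show "\<exists>y\<in>Y. a y \<noteq> a u \<and> a y \<noteq> a v \<and> a y \<noteq> a w"
    using xy(2) z(2-4) unfolding xy(4) by blast
qed

text \<open>A point of \<open>Y\<close> with fresh \<open>a\<close>-label must agree with both
  \<open>p\<close> and \<open>p'\<close> in \<open>b\<close> or \<open>c\<close>, so its last two
  labels are \<open>(b p, c p')\<close> or \<open>(b p', c p)\<close>. If the second pair never
  occurred, the classes of \<open>b p\<close> and \<open>c p'\<close> would cover \<open>X\<close>,
  which turns out to be too restrictive.\<close>

lemma uncovered3_type:
  assumes unc: "uncovered3 X Y a b c" and p: "p \<in> X" "p' \<in> X"
    and ne: "a p \<noteq> a p'" "b p \<noteq> b p'" "c p \<noteq> c p'"
  shows "\<exists>q\<in>Y. a q \<noteq> a p \<and> a q \<noteq> a p' \<and> b q = b p' \<and> c q = c p"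
proof (rule ccontr)
  assume none: "\<not> ?thesis"
  note agree = uncovered3_agree[OF unc]
  have type: "b y = b p \<and> c y = c p'" if y: "y \<in> Y" "a y \<noteq> a p" "a y \<noteq> a p'" for y
  proof -
    have "\<not> (b y = b p' \<and> c y = c p)" using none y by blast
    then show ?thesis using agree[OF p(1) y(1)] agree[OF p(2) y(1)] y(2,3) ne by argo
  qed
  obtain q2 where q2: "q2 \<in> Y" "a q2 \<noteq> a p" "a q2 \<noteq> a p'"
    using uncovered3_fresh(2)[OF unc, of p p' p'] p by blast
  obtain q3 where q3: "q3 \<in> Y" "a q3 \<noteq> a p" "a q3 \<noteq> a p'" "a q3 \<noteq> a q2"
    using uncovered3_fresh(2)[OF unc, of p p' q2] p q2(1) by blast
  \<comment> \<open>Both \<open>q2\<close> and \<open>q3\<close> have last labels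
    \<open>(b p, c p')\<close>, and \<open>x\<close> can match at most one of their distinct
    \<open>a\<close>-labels.\<close>
  have X: "b x = b p \<or> c x = c p'" if "x \<in> X" for x
    using agree[OF that q2(1)] agree[OF that q3(1)] type[OF q2] type[OF q3(1-3)] q3(4) by argo
  \<comment> \<open>Since \<open>b p\<close> and \<open>c p'\<close> already cover \<open>X\<close>,
    whatever escapes them lies in \<open>Y\<close>; the class of \<open>a u\<close> can be chosen
    freely.\<close>
  have cover_fails: "\<exists>y\<in>Y. a y \<noteq> a u \<and> b y \<noteq> b p \<and> c y \<noteq> c p'" if u: "u \<in> X" for u
  proof -
    obtain z where "z \<in> X \<union> Y" and z: "a z \<noteq> a u \<and> b z \<noteq> b p \<and> c z \<noteq> c p'"
      using uncovered3_escape[OF unc, of u p p'] p u by blast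
    then have "z \<in> Y" using X[of z] by blast
    with z show ?thesis by blast
  qed
  obtain r where r: "r \<in> Y" "a r \<noteq> a p'" "b r \<noteq> b p" "c r \<noteq> c p'"
    using cover_fails[OF p(2)] by blast
  obtain s where s: "s \<in> Y" "a s \<noteq> a p" "b s \<noteq> b p" "c s \<noteq> c p'"
    using cover_fails[OF p(1)] by blast
  have ar: "a r = a p" using type[OF r(1)] r by blast
  have as: "a s = a p'" using type[OF s(1)] s by blast
  have cs: "c s = c p" using agree[OF p(1) s(1)] s by argo
  \<comment> \<open>Such an \<open>x\<close> has \<open>c x = c p'\<close>, so it can meet
    \<open>r\<close> and \<open>s\<close> only in \<open>a\<close>, where they carry the different
    labels \<open>a p\<close> and \<open>a p'\<close>.\<close>
  obtain x where x: "x \<in> X" "b x \<noteq> b p" "b x \<noteq> b r" "b x \<noteq> b s"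
    using uncovered3_fresh(1)[OF uncovered3_rotate[OF unc], of p r s] p(1) r(1) s(1) by blast
  have "c x = c p'" using X[OF x(1)] x(2) by blast
  then show False
    using agree[OF x(1) r(1)] agree[OF x(1) s(1)] r(4) x ar as cs ne by argo
qed

lemma uncovered3_both_types:
  assumes unc: "uncovered3 X Y a b c" and p: "p \<in> X" "p' \<in> X"
    and ne: "a p \<noteq> a p'" "b p \<noteq> b p'" "c p \<noteq> c p'"
  obtains q q' where "q \<in> Y" "q' \<in> Y" "a q \<noteq> a p" "a q \<noteq> a p'" "a q' \<noteq> a p" "a q' \<noteq> a p'"
    "a q \<noteq> a q'" "b q = b p" "c q = c p'" "b q' = b p'" "c q' = c p"
proof -
  obtain q' where q': "q' \<in> Y" "a q' \<noteq> a p" "a q' \<noteq> a p'" "b q' = b p'" "c q' = c p"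
    using uncovered3_type[OF unc p ne] by blast
  obtain q where q: "q \<in> Y" "a q \<noteq> a p" "a q \<noteq> a p'" "b q = b p" "c q = c p'"
    using uncovered3_type[OF unc p(2,1) ne[symmetric]] by blast
  show thesis
  proof (cases "a q = a q'")
    case False
    with q q' show thesis using that by blast
  next
    case True
    \<comment> \<open>If the two types share their \<open>a\<close>-label, a third fresh point
      \<open>r\<close> replaces the one of its own type.\<close>
    obtain r where r: "r \<in> Y" "a r \<noteq> a p" "a r \<noteq> a p'" "a r \<noteq> a q"
      using uncovered3_fresh(2)[OF unc, of p p' q] p q(1) by blast
    have "b r = b p \<and> c r = c p' \<or> b r = b p' \<and> c r = c p"
      using uncovered3_agree[OF unc p(1) r(1)] uncovered3_agree[OF unc p(2) r(1)] r(2,3) ne by argo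
    then show thesis
    proof
      assume "b r = b p \<and> c r = c p'"
      then show thesis using r q' True by (intro that[of r q']) auto
    next
      assume "b r = b p' \<and> c r = c p"
      then show thesis using r q by (intro that[of q r]) auto
    qed
  qed
qed

lemma uncovered3_False:
  assumes unc: "uncovered3 X Y a b c" and "X \<noteq> {}"
  shows False
proof -
  note agree = uncovered3_agree[OF unc]
  obtain p where p: "p \<in> X" using \<open>X \<noteq> {}\<close> by blast
  obtain p' where "p' \<in> X \<union> Y" and ne': "a p' \<noteq> a p" "b p' \<noteq> b p" "c p' \<noteq> c p"
    using uncovered3_escape[OF unc, of p p p] p by blast
  note ne = ne'[symmetric]
  \<comment> \<open>A point of \<open>Y\<close> would agree with \<open>p\<close> somewhere.\<close>
  have p': "p' \<in> X" using agree[OF p, of p'] \<open>p' \<in> X \<union> Y\<close> ne by blast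
  obtain x where x: "x \<in> X" "a x \<noteq> a p" "a x \<noteq> a p'"
    using uncovered3_fresh(1)[OF unc, of p p' p'] p p' by blast
  have unc': "uncovered3 X Y b c a" using unc by (rule uncovered3_rotate)
  then have unc'': "uncovered3 X Y c a b" by (rule uncovered3_rotate)
  obtain q r where q: "q \<in> Y" "r \<in> Y" "b q \<noteq> b p" "b q \<noteq> b p'" "b r \<noteq> b p" "b r \<noteq> b p'"
      "b q \<noteq> b r" "c q = c p" "a q = a p'" "c r = c p'" "a r = a p"
    by (rule uncovered3_both_types[OF unc' p p' ne(2,3,1)])
  obtain s where s: "s \<in> Y" "c s \<noteq> c p" "c s \<noteq> c p'" "a s = a p" "b s = b p'"
    using uncovered3_type[OF unc'' p' p ne'(3,1,2)] by blast
  obtain t where t: "t \<in> Y" "c t \<noteq> c p" "c t \<noteq> c p'" "a t = a p'" "b t = b p"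
    using uncovered3_type[OF unc'' p p' ne(3,1,2)] by blast
  \<comment> \<open>As \<open>a x\<close> is fresh, \<open>x\<close> must meet all four points in
    \<open>b\<close> or \<open>c\<close>. Meeting \<open>q\<close> and \<open>r\<close> forces
    \<open>b x\<close> to be \<open>b q\<close> or \<open>b r\<close>, hence fresh, and
    \<open>c x\<close> to be \<open>c p\<close> or \<open>c p'\<close>. Then \<open>x\<close> cannot
    meet \<open>s\<close>, whose \<open>b\<close>-label is \<open>b p'\<close> and whose
    \<open>c\<close>-label is fresh.\<close>
  show False
    using agree[OF x(1) q(1)] agree[OF x(1) q(2)] agree[OF x(1) s(1)] agree[OF x(1) t(1)]
      x(2,3) q(3-) s(2-) t(2-) ne by argo
qed

section \<open>Covers by two or three label classes, each given by an index and a
  representative\<close>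

definition labels_cover :: "nat \<Rightarrow> 'v set \<Rightarrow> (nat \<Rightarrow> 'v \<Rightarrow> 'l) \<Rightarrow> bool" where
  "labels_cover k V l \<longleftrightarrow>
     (\<exists>J \<subseteq> {..<k} \<times> V. finite J \<and> card J \<le> k \<and> (\<forall>z\<in>V. \<exists>(i, v)\<in>J. l i z = l i v))"

lemma labels_cover_two:
  assumes agree: "\<And>x y. x \<in> X \<Longrightarrow> y \<in> Y \<Longrightarrow> \<exists>i<2. l i x = l i y"
    and img: "\<And>i. i < 2 \<Longrightarrow> l i ` X = l i ` Y" and "X \<noteq> {}"
  shows "labels_cover 2 (X \<union> Y) l"
proof -
  have ag: "l 0 x = l 0 y \<or> l 1 x = l 1 y" if "x \<in> X" "y \<in> Y" for x y
    using agree[OF that] by (auto simp: less_2_cases_iff One_nat_def[symmetric] simp del: One_nat_def)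
  obtain p where p: "p \<in> X" using \<open>X \<noteq> {}\<close> by blast
  show ?thesis
  proof (cases "\<exists>p'\<in>X. l 0 p' \<noteq> l 0 p \<and> l 1 p' \<noteq> l 1 p")
    case True
    then obtain p' where p': "p' \<in> X" "l 0 p' \<noteq> l 0 p" "l 1 p' \<noteq> l 1 p" by blast
    \<comment> \<open>A \<open>y\<close> missing both labels in coordinate 0 would agree with
      \<open>p\<close> and \<open>p'\<close> in coordinate 1, where they differ. Equal projections
      then carry the bound over to \<open>X\<close>.\<close>
    have Y: "l 0 y = l 0 p \<or> l 0 y = l 0 p'" if "y \<in> Y" for y
      using ag[OF p that] ag[OF p'(1) that] p' by auto
    have "l 0 z = l 0 p \<or> l 0 z = l 0 p'" if "z \<in> X \<union> Y" for z
      using that Y img[of 0] by (smt (verit) Un_iff imageE imageI pos2)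
    then show ?thesis unfolding labels_cover_def
      using p p' by (intro exI[of _ "{(0, p), (0, p')}"]) (auto simp: card_insert_if)
  next
    case False
    \<comment> \<open>Now the two classes of \<open>p\<close> cover \<open>X\<close> as well as
      \<open>Y\<close>.\<close>
    then show ?thesis unfolding labels_cover_def
      using p ag[OF p] by (intro exI[of _ "{(0, p), (1, p)}"]) (fastforce simp: card_insert_if)
  qed
qed

lemma labels_cover_three:
  assumes agree: "\<And>x y. x \<in> X \<Longrightarrow> y \<in> Y \<Longrightarrow> \<exists>i<3. l i x = l i y"
    and img: "\<And>i. i < 3 \<Longrightarrow> l i ` X = l i ` Y" and "X \<noteq> {}"
  shows "labels_cover 3 (X \<union> Y) l"
proof (rule ccontr)
  assume no_cover: "\<not> ?thesis"
  have escape: "\<exists>z\<in>X \<union> Y. l i z \<noteq> l i u \<and> l j z \<noteq> l j v \<and> l k z \<noteq> l k w"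
    if "i < 3" "j < 3" "k < 3" "u \<in> X \<union> Y" "v \<in> X \<union> Y" "w \<in> X \<union> Y" for i j k u v w
  proof (rule ccontr)
    assume "\<not> ?thesis"
    then have "labels_cover 3 (X \<union> Y) l" unfolding labels_cover_def
      \<comment> \<open>The three pairs may coincide, so the cover has at most three
        classes.\<close>
      using that by (intro exI[of _ "{(i, u), (j, v), (k, w)}"]) (auto simp: card_insert_if)
    with no_cover show False by blast
  qed
  have three: "i < 3 \<longleftrightarrow> i = 0 \<or> i = 1 \<or> i = 2" for i :: nat by auto
  have "uncovered3 X Y (l 0) (l 1) (l 2)"
    unfolding uncovered3_def
  proof (intro conjI ballI)
    show "l 0 x = l 0 y \<or> l 1 x = l 1 y \<or> l 2 x = l 2 y" if "x \<in> X" "y \<in> Y" for x y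
      using agree[OF that] unfolding three by blast
    show "\<exists>z\<in>X \<union> Y. l 0 z \<noteq> l 0 u \<and> l 1 z \<noteq> l 1 v \<and> l 2 z \<noteq> l 2 w"
      if "u \<in> X \<union> Y" "v \<in> X \<union> Y" "w \<in> X \<union> Y" for u v w
      by (rule escape[OF _ _ _ that]) simp_all
  next
    fix h assume "h \<in> {l 0, l 1, l 2}"
    then have "h \<in> l ` {0, 1, 2}" by simp
    then obtain i where "i \<in> {0, 1, 2}" and h: "h = l i" by (elim imageE)
    then have i: "i < 3" by auto
    show "h ` X = h ` Y" unfolding h using i by (rule img)
    show "\<exists>z\<in>X \<union> Y. h z \<noteq> h u \<and> h z \<noteq> h v \<and> h z \<noteq> h w"
      if "u \<in> X \<union> Y" "v \<in> X \<union> Y" "w \<in> X \<union> Y" for u v w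
      unfolding h by (rule escape[OF i i i that])
  qed
  then show False using \<open>X \<noteq> {}\<close> by (rule uncovered3_False)
qed

section \<open>Monochromatic components\<close>

abbreviation component :: "'a pair_pre_digraph \<Rightarrow> ('a set \<Rightarrow> nat) \<Rightarrow> nat \<Rightarrow> 'a \<Rightarrow> 'a set" where
  "component G f c \<equiv> pre_digraph.scc_of (with_proj (color_subgraph G f c))"

lemma bicliqueE:
  assumes "biclique G"
  obtains X Y where "finite X" "finite Y" "X \<noteq> {}" "Y \<noteq> {}" "X \<inter> Y = {}"
    "pverts G = X \<union> Y" "parcs G = X \<times> Y \<union> Y \<times> X"
  using assms that unfolding biclique_def complete_bipartite_digraph_pair_def
  by (metis card.empty card.infinite less_irrefl)

lemma color_subgraph_sym:
  assumes "biclique G"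
  shows "pair_sym_digraph (color_subgraph G f c)"
proof -
  obtain X Y where "pverts G = X \<union> Y" "parcs G = X \<times> Y \<union> Y \<times> X"
    using assms by (rule bicliqueE)
  then show ?thesis
    by unfold_locales (auto simp: color_subgraph_def symmetric_def sym_def insert_commute)
qed

text \<open>Components are subgraphs; this passes to their vertex sets, which serve as the
  labels.\<close>

lemma mono_components_verts:
  assumes "biclique G"
  shows "verts ` mono_components k G f = (\<Union>c<k. component G f c ` pverts G)"
proof -
  have "verts ` pre_digraph.sccs (with_proj (color_subgraph G f c)) = component G f c ` pverts G" for c
  proof -
    interpret pair_sym_digraph "color_subgraph G f c" using assms by (rule color_subgraph_sym)
    show ?thesis
      using sccs_verts_conv sccs_verts_conv_scc_of by (simp add: color_subgraph_def)
  qed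
  then show ?thesis unfolding mono_components_def by (simp add: image_UN)
qed

lemma component_self:
  assumes "biclique G" "v \<in> pverts G"
  shows "v \<in> component G f c v"
proof -
  interpret pair_sym_digraph "color_subgraph G f c" using assms(1) by (rule color_subgraph_sym)
  show ?thesis using assms(2) by (intro in_scc_of_self) (simp add: color_subgraph_def)
qed

lemma component_arc:
  assumes "biclique G" "(u, v) \<in> parcs G" "f {u, v} = c"
  shows "component G f c u = component G f c v"
proof -
  interpret pair_sym_digraph "color_subgraph G f c" using assms(1) by (rule color_subgraph_sym)
  have "u \<rightarrow>\<^sup>*\<^bsub>color_subgraph G f c\<^esub> v"
    using assms by (intro reachable_adjI) (simp add: color_subgraph_def)
  moreover from this have "v \<rightarrow>\<^sup>*\<^bsub>color_subgraph G f c\<^esub> u"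
    by (rule symmetric_reachable')
  ultimately show ?thesis unfolding scc_of_def by (blast intro: reachable_trans)
qed

lemma coverable_if_labels_cover:
  assumes G: "biclique G" and cov: "labels_cover k (pverts G) (component G f)"
  shows "coverable k G f k"
proof -
  obtain J where J: "J \<subseteq> {..<k} \<times> pverts G" "finite J" "card J \<le> k"
    and cov: "\<And>z. z \<in> pverts G \<Longrightarrow> \<exists>(i, v)\<in>J. component G f i z = component G f i v"
    using cov unfolding labels_cover_def by blast
  have "\<exists>C. C \<in> mono_components k G f \<and> verts C = component G f (fst j) (snd j)" if "j \<in> J" for j
  proof -
    have "component G f (fst j) (snd j) \<in> verts ` mono_components k G f"
      using that J(1) unfolding mono_components_verts[OF G] by (cases j) auto
    then show ?thesis by auto
  qed
  then obtain C where C: "\<And>j. j \<in> J \<Longrightarrow> C j \<in> mono_components k G f"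
      "\<And>j. j \<in> J \<Longrightarrow> verts (C j) = component G f (fst j) (snd j)"
    by metis
  show ?thesis unfolding coverable_def
  proof (intro exI[of _ "C ` J"] conjI)
    show "card (C ` J) \<le> k" using J card_image_le le_trans by blast
    show "pverts G \<subseteq> (\<Union>D\<in>C ` J. verts D)"
    proof
      fix z assume z: "z \<in> pverts G"
      obtain i v where "(i, v) \<in> J" "component G f i z = component G f i v"
        using cov[OF z] by blast
      then show "z \<in> (\<Union>D\<in>C ` J. verts D)"
        using C(2)[of "(i, v)"] component_self[OF G z, of f i] by auto
    qed
  qed (use J C in auto)
qed

lemma coverable_two_three:
  fixes G :: "'a pair_pre_digraph"
  assumes k: "k \<in> {2, 3}" and G: "biclique G" and f: "spanning_coloring k G f"
  shows "coverable k G f k"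
proof -
  obtain X Y where XY: "X \<noteq> {}" "Y \<noteq> {}" "X \<inter> Y = {}"
      "pverts G = X \<union> Y" "parcs G = X \<times> Y \<union> Y \<times> X"
    using G by (rule bicliqueE)
  \<comment> \<open>The color of the edge \<open>xy\<close> is the coordinate of agreement.\<close>
  have agree: "\<exists>i<k. component G f i x = component G f i y" if "x \<in> X" "y \<in> Y" for x y
  proof -
    have "(x, y) \<in> parcs G" using that XY by blast
    then show ?thesis
      using f component_arc[OF G] unfolding spanning_coloring_def edge_coloring_def by blast
  qed
  have nbr: "\<exists>u. (v, u) \<in> parcs G \<and> component G f i v = component G f i u"
    if "i < k" "v \<in> pverts G" for i v
    using f that component_arc[OF G] unfolding spanning_coloring_def by metis
  \<comment> \<open>Spanning gives each vertex a neighbor of color \<open>i\<close>, which lies in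
    the other part and in the same component.\<close>
  have img: "component G f i ` X = component G f i ` Y" if i: "i < k" for i
  proof (intro equalityI subsetI; elim imageE)
    fix L x assume "L = component G f i x" "x \<in> X"
    then show "L \<in> component G f i ` Y" using nbr[OF i, of x] XY by auto
  next
    fix L y assume "L = component G f i y" "y \<in> Y"
    then show "L \<in> component G f i ` X" using nbr[OF i, of y] XY by auto
  qed
  have "labels_cover k (X \<union> Y) (component G f)"
    using k labels_cover_two[of X Y "component G f"] labels_cover_three[of X Y "component G f"]
      agree img XY(1) by auto
  then show ?thesis using coverable_if_labels_cover[OF G] XY(4) by simp
qed

section \<open>The cyclic coloring of the balanced biclique\<close>

definition cyclic_biclique :: "nat \<Rightarrow> nat pair_pre_digraph" where
  "cyclic_biclique k =
     \<lparr> pverts = {..<2 * k}, parcs = {..<k} \<times> {k..<2 * k} \<union> {k..<2 * k} \<times> {..<k} \<rparr>"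

definition cyclic_coloring :: "nat \<Rightarrow> nat set \<Rightarrow> nat" where
  "cyclic_coloring k e = (\<Sum>e) mod k"

text \<open>The parts are disjoint, so \<open>{u, v}\<close> has two elements and its sum is
  \<open>u + v\<close>.\<close>

lemma cyclic_coloring_arc:
  "(u, v) \<in> parcs (cyclic_biclique k) \<Longrightarrow> cyclic_coloring k {u, v} = (u + v) mod k"
  by (subst cyclic_coloring_def, subst sum.insert) (auto simp: cyclic_biclique_def)

lemma biclique_cyclic:
  assumes "k > 0"
  shows "biclique (cyclic_biclique k)"
proof -
  have "K\<^bsub>k,k\<^esub> (with_proj (cyclic_biclique k))"
    unfolding complete_bipartite_digraph_pair_def
    by (intro conjI exI[of _ "{..<k}"] exI[of _ "{k..<2 * k}"]) (auto simp: cyclic_biclique_def)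
  then show ?thesis using assms unfolding biclique_def by blast
qed

text \<open>Two neighbors of \<open>u\<close> lie in the same part, an interval of length
  \<open>k\<close>, so congruence modulo \<open>k\<close> forces equality.\<close>

lemma cyclic_coloring_proper:
  assumes "(u, v) \<in> parcs (cyclic_biclique k)" "(u, w) \<in> parcs (cyclic_biclique k)"
    and "cyclic_coloring k {u, v} = cyclic_coloring k {u, w}"
  shows "v = w"
  using assms
proof (induct v w rule: linorder_wlog)
  case (le v w)
  have "(u + w) mod k = (u + v) mod k"
    using le by (simp add: cyclic_coloring_arc)
  then have "k dvd w - v"
    using le(1) by (simp add: mod_eq_dvd_iff_nat)
  moreover have "w - v < k"
    using le(2,3) by (auto simp: cyclic_biclique_def)
  ultimately have "w - v = 0"
    by (metis dvd_imp_le not_gr0 not_le)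
  with le(1) show ?case by simp
next
  case (sym v w)
  then show ?case by simp
qed

lemma spanning_cyclic:
  assumes "k > 0"
  shows "spanning_coloring k (cyclic_biclique k) (cyclic_coloring k)"
  unfolding spanning_coloring_def
proof (intro conjI ballI allI impI)
  show "edge_coloring k (cyclic_biclique k) (cyclic_coloring k)"
    using assms by (auto simp: edge_coloring_def cyclic_coloring_def)
next
  fix v c assume v: "v \<in> pverts (cyclic_biclique k)" and c: "c < k"
  \<comment> \<open>This is \<open>c - v\<close> modulo \<open>k\<close>, written so that the
    subtraction on naturals is never truncated.\<close>
  define w where "w = (c + (k - v mod k)) mod k"
  have w: "w < k" using assms by (simp add: w_def)
  have "(v + w) mod k = (v mod k + (c + (k - v mod k))) mod k"
    unfolding w_def by (simp add: mod_simps)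
  also have "\<dots> = (c + k) mod k"
    using mod_le_divisor[OF assms, of v] by (intro arg_cong[of _ _ "\<lambda>x. x mod k"]) linarith
  finally have sum: "(v + w) mod k = c" using c by simp
  \<comment> \<open>Adding \<open>k\<close> moves the vertex into the part opposite \<open>v\<close>
    without changing the color.\<close>
  define u where "u = (if v < k then w + k else w)"
  have "(v, u) \<in> parcs (cyclic_biclique k)"
    using v w by (auto simp: u_def cyclic_biclique_def)
  moreover from this have "cyclic_coloring k {v, u} = c"
    using sum by (simp add: cyclic_coloring_arc) (simp add: u_def flip: add.assoc)
  ultimately show "\<exists>u. (v, u) \<in> parcs (cyclic_biclique k) \<and> cyclic_coloring k {v, u} = c"
    by blast
qed

lemma component_cyclic:
  assumes "k > 0" "v \<in> pverts (cyclic_biclique k)"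
  shows "card (component (cyclic_biclique k) (cyclic_coloring k) c v) \<le> 2"
proof -
  let ?G = "cyclic_biclique k" and ?H = "color_subgraph (cyclic_biclique k) (cyclic_coloring k) c"
  interpret pair_sym_digraph ?H using biclique_cyclic[OF assms(1)] by (rule color_subgraph_sym)
  have arc: "(x, y) \<in> parcs ?H \<longleftrightarrow> (x, y) \<in> parcs ?G \<and> cyclic_coloring k {x, y} = c" for x y
    by (simp add: color_subgraph_def)
  have sym: "(y, x) \<in> parcs ?H" if "(x, y) \<in> parcs ?H" for x y
    using that unfolding arc by (auto simp: cyclic_biclique_def insert_commute)
  have unique: "y = z" if "(x, y) \<in> parcs ?H" "(x, z) \<in> parcs ?H" for x y z
    using that cyclic_coloring_proper[of x y k z] by (simp add: arc)
  \<comment> \<open>Each color class is a matching: a walk from \<open>v\<close> can only go to its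
    partner and back.\<close>
  have reach: "w = v \<or> (v, w) \<in> parcs ?H" if "v \<rightarrow>\<^sup>*\<^bsub>?H\<^esub> w" for w
    using that by (induct rule: reachable_induct) (use unique sym in auto)
  obtain u where "component ?G (cyclic_coloring k) c v \<subseteq> {v, u}"
  proof (cases "\<exists>u. (v, u) \<in> parcs ?H")
    case True
    then obtain u where "(v, u) \<in> parcs ?H" by blast
    then show thesis using that[of u] reach unique unfolding scc_of_def by blast
  next
    case False
    then show thesis using that[of v] reach unfolding scc_of_def by blast
  qed
  then have "card (component ?G (cyclic_coloring k) c v) \<le> card {v, u}"
    by (intro card_mono) auto
  also have "\<dots> \<le> 2" by (simp add: card_insert_if)
  finally show ?thesis .
qed

text \<open>There are \<open>2 * k\<close> vertices, and each component contains at most two of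
  them.\<close>

lemma not_coverable_cyclic:
  assumes "l < k"
  shows "\<not> coverable k (cyclic_biclique k) (cyclic_coloring k) l"
proof
  assume "coverable k (cyclic_biclique k) (cyclic_coloring k) l"
  then obtain \<C> where C: "\<C> \<subseteq> mono_components k (cyclic_biclique k) (cyclic_coloring k)"
      "finite \<C>" "card \<C> \<le> l" "pverts (cyclic_biclique k) \<subseteq> (\<Union>C\<in>\<C>. verts C)"
    unfolding coverable_def by blast
  have k: "k > 0" using assms by simp
  have small: "card (verts C) \<le> 2" "verts C \<subseteq> pverts (cyclic_biclique k)" if "C \<in> \<C>" for C
  proof -
    have "verts C \<in> verts ` mono_components k (cyclic_biclique k) (cyclic_coloring k)"
      using that C(1) by blast
    then obtain c v where "v \<in> pverts (cyclic_biclique k)"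
      "verts C = component (cyclic_biclique k) (cyclic_coloring k) c v"
      unfolding mono_components_verts[OF biclique_cyclic[OF k]] by blast
    then show "card (verts C) \<le> 2" using component_cyclic[OF k] by simp
    have "C \<in> mono_components k (cyclic_biclique k) (cyclic_coloring k)" using that C(1) by blast
    then show "verts C \<subseteq> pverts (cyclic_biclique k)"
      unfolding mono_components_def pre_digraph.sccs_def induced_subgraph_def subgraph_def
      by (auto simp: color_subgraph_def)
  qed
  \<comment> \<open>\<open>card_mono\<close> needs the union to be finite; it lies inside the finite
    vertex set.\<close>
  have fin: "finite (\<Union>C\<in>\<C>. verts C)"
    by (rule finite_subset[of _ "pverts (cyclic_biclique k)"])
      (use small(2) in \<open>auto simp: cyclic_biclique_def\<close>)
  have "2 * k = card (pverts (cyclic_biclique k))" by (simp add: cyclic_biclique_def)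
  also have "\<dots> \<le> card (\<Union>C\<in>\<C>. verts C)" using C(4) fin by (rule card_mono[rotated])
  also have "\<dots> \<le> (\<Sum>C\<in>\<C>. card (verts C))" using C(2) by (rule card_UN_le)
  also have "\<dots> \<le> card \<C> * 2" using sum_bounded_above[of \<C> "\<lambda>C. card (verts C)" 2] small(1) by simp
  finally show False using C(3) assms by simp
qed

theorem theorem1p8:
  fixes k :: nat
  assumes "k \<in> {2, 3}"
  shows "cov2 k = k \<and>
    (\<forall>(G :: 'a pair_pre_digraph) f.
       biclique G \<longrightarrow> spanning_coloring k G f \<longrightarrow> coverable k G f k) \<and>
    (\<exists>(G :: nat pair_pre_digraph) f.
       biclique G \<and> spanning_coloring k G f \<and> (\<forall>l < k. \<not> coverable k G f l))"
proof (intro conjI)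
  have k: "k > 0" using assms by auto
  note sharp = biclique_cyclic[OF k] spanning_cyclic[OF k] not_coverable_cyclic
  show "cov2 k = k" unfolding cov2_def
  proof (rule Least_equality)
    show "\<forall>(G :: nat pair_pre_digraph) f.
        biclique G \<longrightarrow> spanning_coloring k G f \<longrightarrow> coverable k G f k"
      using coverable_two_three[OF assms] by blast
    show "k \<le> l" if "\<forall>(G :: nat pair_pre_digraph) f.
        biclique G \<longrightarrow> spanning_coloring k G f \<longrightarrow> coverable k G f l" for l
      \<comment> \<open>If \<open>l < k\<close>, the cyclic coloring would contradict the assumed
        bound.\<close>
      using that sharp not_le by blast
  qed
  show "\<forall>(G :: 'a pair_pre_digraph) f.
      biclique G \<longrightarrow> spanning_coloring k G f \<longrightarrow> coverable k G f k"
    using coverable_two_three[OF assms] by blast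
  show "\<exists>(G :: nat pair_pre_digraph) f.
      biclique G \<and> spanning_coloring k G f \<and> (\<forall>l < k. \<not> coverable k G f l)"
    using sharp by blast
qed

end
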